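(* Let $(V,h)$ be a metric vector space. For $X,Y\in\mathcal{MC}(V^* )$, $$\rho(X\ast Y)=\tfrac12\left(\widehat X(\rho(Y))+\widehat Y(\rho(X))\right),\qquad \operatorname{s}(X\ast Y)=\langle\rho(X),\rho(Y)\rangle,$$ where $\widehat X,\widehat Y$ act on $S^2V^*$. In particular, the subspace $\mathcal{MC}_W(V^* )=\ker\rho\subset\mathcal{MC}(V^* )$ is a subalgebra of $(\mathcal{MC}(V^* ),\ast)$.
   Context: All vector spaces are finite-dimensional over $\mathbb{R}$. A metric vector space $(V,h)$ has a nondegenerate symmetric bilinear form $h_{ij}$ of any signature; indices are raised and lowered with $h$; brackets around indices denote complete antisymmetrization, normalized to be a projection. $\mathcal{MC}(V^* )=\{Y_{ijkl}\in\otimes^4V^*: Y_{[ij]kl}=Y_{ijkl}=Y_{ij[kl]},\ Y_{[ijk]l}=0\}$; $\rho(Y)_{ij}=Y_{pij}{}^p\in S^2V^*$; $\operatorname{s}(Y)=h^{ij}\rho(Y)_{ij}$; for $\alpha,\beta\in S^2V^*$, $\langle\alpha,\beta\rangle=\alpha_{ij}\beta^{ij}$. For $X\in\mathcal{MC}(V^* )$, $\widehat X\in\operatorname{End}(\otimes^kV^* )$ is $\widehat X(\alpha)_{i_1\dots i_k}=\tfrac1k\sum_{r\ne s}X^{p}{}_{i_ri_s}{}^{q}\,\alpha_{i_1\dots p\dots q\dots i_k}$, the sum running over ordered pairs $(r,s)$ of distinct positions, with $p$ in position $r$ and $q$ in position $s$; on $S^2V^*$ it is $\widehat X(\alpha)_{ij}=\alpha^{pq}X_{ipqj}$.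 The commutative multiplication on $\mathcal{MC}(V^* )$ is $X\ast Y:=\widehat X(Y)$. *)

theory Defs
  imports "HOL-Analysis.Analysis" "HOL-Library.Function_Algebras"
begin

text \<open>
  The vector space \<open>V\<close> is (the universe of) a type of class \<^class>\<open>real_vector\<close>; finite dimension
  is an assumption, so that dimension \<open>0\<close> is not excluded.
\<close>

definition metric_vector_space :: "('v::real_vector \<Rightarrow> 'v \<Rightarrow> real) \<Rightarrow> bool" where
  "metric_vector_space h \<longleftrightarrow>
     (\<exists>B::'v set. finite B \<and> span B = UNIV) \<and>
     bilinear h \<and> (\<forall>x y. h x y = h y x) \<and>
     (\<forall>x. (\<forall>y. h x y = 0) \<longrightarrow> x = 0)"

definition is_basis :: "'v::real_vector set \<Rightarrow> bool" where
  "is_basis B \<longleftrightarrow> finite B \<and> independent B \<and> span B = UNIV"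

text \<open>
  \<open>hdual h B b\<close> is the element dual to \<open>b\<close> of the \<open>h\<close>-dual basis, which in coordinates is
  \<open>e\<^sup>i = h\<^sup>i\<^sup>j e\<^sub>j\<close>, so that \<open>T(e\<^sub>i, e\<^sup>i)\<close>, summed over \<open>i\<close>, is the contraction
  \<open>h\<^sup>i\<^sup>j T\<^sub>i\<^sub>j = T\<^sub>i\<^sup>i\<close>. For bilinear \<open>T\<close> this does not depend on the basis: see \<open>contract_basis\<close>.
\<close>

definition hdual :: "('v::real_vector \<Rightarrow> 'v \<Rightarrow> real) \<Rightarrow> 'v set \<Rightarrow> 'v \<Rightarrow> 'v" where
  "hdual h B b = (THE v. \<forall>c\<in>B. h v c = (if c = b then 1 else 0))"

definition contract :: "('v::real_vector \<Rightarrow> 'v \<Rightarrow> real) \<Rightarrow> ('v \<Rightarrow> 'v \<Rightarrow> real) \<Rightarrow> real" where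
  "contract h T = (let B = (SOME B. is_basis B) in \<Sum>b\<in>B. T b (hdual h B b))"

lemma is_basis_exists:
  assumes "metric_vector_space (h :: 'v::real_vector \<Rightarrow> 'v \<Rightarrow> real)"
  shows "\<exists>B::'v set. is_basis B"
proof -
  obtain A :: "'v set" where A: "finite A" "span A = UNIV"
    using assms unfolding metric_vector_space_def by blast
  obtain B where B: "B \<subseteq> A" "independent B" "A \<subseteq> span B"
    using maximal_independent_subset[of A] by blast
  have "span B = UNIV"
    using A(2) B(3) span_mono[of A "span B"] by (simp add: span_span top.extremum_unique)
  then show ?thesis
    using A(1) B finite_subset unfolding is_basis_def by blast
qed

lemma eq_on_basis:
  assumes "metric_vector_space h" "is_basis B" "\<And>c. c \<in> B \<Longrightarrow> h v c = h w c"
  shows "v = w"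
proof -
  have bil: "bilinear h" and nd: "\<And>x. (\<forall>y. h x y = 0) \<Longrightarrow> x = 0"
    using assms(1) unfolding metric_vector_space_def by blast+
  have "h v y = h w y" for y
  proof (rule linear_eq_on[where f = "h v" and g = "h w" and B = B])
    show "linear (h v)" "linear (h w)" using bil unfolding bilinear_def by blast+
    show "y \<in> span B" using assms(2) unfolding is_basis_def by blast
  qed (use assms(3) in blast)
  then have "h (v - w) y = 0" for y
    by (simp add: bilinear_lsub[OF bil])
  then show ?thesis using nd[of "v - w"] by simp
qed

lemma hdual_basis:
  assumes h: "metric_vector_space h" and B: "is_basis B" and b: "b \<in> B" and c: "c \<in> B"
  shows "h (hdual h B b) c = (if c = b then 1 else 0)"
proof -
  have bil: "bilinear h" using h unfolding metric_vector_space_def by blast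
  have fB: "finite B" and iB: "independent B" and sB: "span B = UNIV"
    using B unfolding is_basis_def by blast+
  interpret fd: finite_dimensional_vector_space "(*\<^sub>R)" B
    using fB iB sB by unfold_locales (auto simp: dependent_raw_def span_raw_def)
  define f where "f v = (\<Sum>c\<in>B. h v c *\<^sub>R c)" for v
  have lf: "linear f"
    unfolding f_def
    by (rule linearI) (simp_all add: bilinear_ladd[OF bil] bilinear_lmul[OF bil]
        scaleR_add_left sum.distrib scaleR_sum_right)
  have coeff: "\<forall>c\<in>B. u c = w c" if "(\<Sum>c\<in>B. u c *\<^sub>R c) = (\<Sum>c\<in>B. w c *\<^sub>R c)"
    for u w :: "_ \<Rightarrow> real"
  proof
    fix x assume "x \<in> B"
    have "(\<Sum>c\<in>B. (u c - w c) *\<^sub>R c) = 0"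
      using that by (simp add: scaleR_diff_left sum_subtractf)
    then show "u x = w x"
      using independentD[OF iB fB order_refl, of "\<lambda>c. u c - w c" x] \<open>x \<in> B\<close> by simp
  qed
  have "inj f"
  proof (rule injI)
    fix v w assume "f v = f w"
    then show "v = w"
      using coeff[of "h v" "h w"] eq_on_basis[OF h B] unfolding f_def by blast
  qed
  then have "surj f"
    using fd.linear_inj_imp_surj[of f] lf by (simp add: linear_def)
  then obtain v where "f v = b" by (metis surjD)
  then have "(\<Sum>c\<in>B. h v c *\<^sub>R c) = (\<Sum>c\<in>B. (if c = b then 1 else 0) *\<^sub>R c)"
    using fB b by (simp add: f_def if_distrib[of "\<lambda>r. r *\<^sub>R _"] cong: if_cong)
  then have v: "\<forall>c\<in>B. h v c = (if c = b then 1 else 0)"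
    using coeff[of "h v" "\<lambda>c. if c = b then 1 else 0"] by blast
  have "\<forall>c\<in>B. h (hdual h B b) c = (if c = b then 1 else 0)"
    unfolding hdual_def
  proof (rule theI[of _ v])
    fix w assume "\<forall>c\<in>B. h w c = (if c = b then 1 else 0)"
    then show "w = v" using v eq_on_basis[OF h B] by metis
  qed (fact v)
  then show ?thesis using c by blast
qed

lemma basis_expand:
  assumes h: "metric_vector_space h" and B: "is_basis B"
  shows "v = (\<Sum>b\<in>B. h (hdual h B b) v *\<^sub>R b)"
    and "v = (\<Sum>b\<in>B. h v b *\<^sub>R hdual h B b)"
proof -
  have bil: "bilinear h" using h unfolding metric_vector_space_def by blast
  have fB: "finite B" using B unfolding is_basis_def by blast
  show *: "v = (\<Sum>b\<in>B. h v b *\<^sub>R hdual h B b)" for v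
  proof (rule eq_on_basis[OF h B])
    fix c assume c: "c \<in> B"
    have lin: "linear (\<lambda>x. h x c)" using bil unfolding bilinear_def by blast
    have "h (\<Sum>b\<in>B. h v b *\<^sub>R hdual h B b) c = (\<Sum>b\<in>B. h v b * h (hdual h B b) c)"
      by (simp add: linear_sum[OF lin] linear_scale[OF lin])
    also have "\<dots> = (\<Sum>b\<in>B. if c = b then h v b else 0)"
      by (intro sum.cong) (auto simp: hdual_basis[OF h B _ c])
    also have "\<dots> = h v c" using fB c by simp
    finally show "h v c = h (\<Sum>b\<in>B. h v b *\<^sub>R hdual h B b) c" by simp
  qed
  show "v = (\<Sum>b\<in>B. h (hdual h B b) v *\<^sub>R b)"
  proof (rule linear_eq_on[where f = "\<lambda>v. v" and B = B])
    show "linear (\<lambda>v. v)" by (rule linear_ident)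
    show "linear (\<lambda>v. \<Sum>b\<in>B. h (hdual h B b) v *\<^sub>R b)"
      by (rule linearI) (simp_all add: bilinear_radd[OF bil] bilinear_rmul[OF bil]
          scaleR_add_left sum.distrib scaleR_sum_right)
    show "v \<in> span B" using B unfolding is_basis_def by blast
    fix c assume c: "c \<in> B"
    have "(\<Sum>b\<in>B. h (hdual h B b) c *\<^sub>R b) = (\<Sum>b\<in>B. if c = b then b else 0)"
      by (intro sum.cong) (auto simp: hdual_basis[OF h B _ c])
    then show "c = (\<Sum>b\<in>B. h (hdual h B b) c *\<^sub>R b)" using fB c by simp
  qed
qed

lemma contract_basis:
  assumes h: "metric_vector_space h" and B: "is_basis B" and T: "bilinear T"
  shows "contract h T = (\<Sum>b\<in>B. T b (hdual h B b))"
proof -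
  define C :: "'a set" where "C = (SOME C. is_basis C)"
  have C: "is_basis C"
    using is_basis_exists[OF h] unfolding C_def by (rule someI_ex)
  have lin: "linear (T x)" "linear (\<lambda>x. T x y)" for x y
    using T unfolding bilinear_def by blast+
  have "(\<Sum>b\<in>B. T b (hdual h B b))
      = (\<Sum>b\<in>B. \<Sum>c\<in>C. h (hdual h B b) c * T b (hdual h C c))"
  proof (intro sum.cong refl)
    fix b
    have "T b (hdual h B b) = T b (\<Sum>c\<in>C. h (hdual h B b) c *\<^sub>R hdual h C c)"
      using basis_expand(2)[OF h C, of "hdual h B b"] by simp
    then show "T b (hdual h B b) = (\<Sum>c\<in>C. h (hdual h B b) c * T b (hdual h C c))"
      by (simp add: linear_sum[OF lin(1)] linear_scale[OF lin(1)])
  qed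
  also have "\<dots> = (\<Sum>c\<in>C. \<Sum>b\<in>B. h (hdual h B b) c * T b (hdual h C c))"
    by (rule sum.swap)
  also have "\<dots> = (\<Sum>c\<in>C. T c (hdual h C c))"
  proof (intro sum.cong refl)
    fix c
    have "T c (hdual h C c) = T (\<Sum>b\<in>B. h (hdual h B b) c *\<^sub>R b) (hdual h C c)"
      using basis_expand(1)[OF h B, of c] by simp
    then show "(\<Sum>b\<in>B. h (hdual h B b) c * T b (hdual h C c)) = T c (hdual h C c)"
      by (simp add: linear_sum[OF lin(2)] linear_scale[OF lin(2)])
  qed
  finally show ?thesis
    unfolding contract_def Let_def C_def by simp
qed

text \<open>
  A covariant \<open>k\<close>-tensor is a \<open>k\<close>-linear form, taking its arguments as a list of length \<open>k\<close>
  and extended by \<open>0\<close> to lists of other lengths, so that \<open>tensors k\<close> is isomorphic to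
  the \<open>k\<close>-th tensor power of the dual space and equality of tensors is equality of functions.
  Positions are counted from \<open>0\<close>.
\<close>

type_synonym 'v tensor = "'v list \<Rightarrow> real"

definition tscale :: "real \<Rightarrow> 'v tensor \<Rightarrow> 'v tensor" where
  "tscale c \<alpha> = (\<lambda>vs. c * \<alpha> vs)"

interpretation tensor: vector_space tscale
  by unfold_locales (auto simp: tscale_def fun_eq_iff algebra_simps)

definition tensors :: "nat \<Rightarrow> 'v::real_vector tensor set" where
  "tensors k = {\<alpha>. (\<forall>vs r. length vs = k \<and> r < k \<longrightarrow> linear (\<lambda>v. \<alpha> (vs[r := v])))
                  \<and> (\<forall>vs. length vs \<noteq> k \<longrightarrow> \<alpha> vs = 0)}"

definition MC :: "'v::real_vector tensor set" where
  "MC = {Y \<in> tensors 4.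
     (\<forall>i j k l. (1/2) * (Y [i,j,k,l] - Y [j,i,k,l]) = Y [i,j,k,l]) \<and>
     (\<forall>i j k l. Y [i,j,k,l] = (1/2) * (Y [i,j,k,l] - Y [i,j,l,k])) \<and>
     (\<forall>i j k l. (1/6) * (Y [i,j,k,l] + Y [j,k,i,l] + Y [k,i,j,l]
                       - Y [j,i,k,l] - Y [i,k,j,l] - Y [k,j,i,l]) = 0)}"

definition ric :: "('v::real_vector \<Rightarrow> 'v \<Rightarrow> real) \<Rightarrow> 'v tensor \<Rightarrow> 'v tensor" where
  "ric h Y = (\<lambda>vs. if length vs = 2 then contract h (\<lambda>p p'. Y [p, vs!0, vs!1, p']) else 0)"

definition scal :: "('v::real_vector \<Rightarrow> 'v \<Rightarrow> real) \<Rightarrow> 'v tensor \<Rightarrow> real" where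
  "scal h Y = contract h (\<lambda>i j. ric h Y [i, j])"

definition inner2 :: "('v::real_vector \<Rightarrow> 'v \<Rightarrow> real) \<Rightarrow> 'v tensor \<Rightarrow> 'v tensor \<Rightarrow> real" where
  "inner2 h \<alpha> \<beta> = contract h (\<lambda>i i'. contract h (\<lambda>j j'. \<alpha> [i, j] * \<beta> [i', j']))"

text \<open>
  The raised indices of \<open>X\<close> are contracted, as \<open>p'\<close> and \<open>q'\<close>, with the slots \<open>r\<close> and \<open>s\<close> of
  \<open>\<alpha>\<close>, filled with \<open>p\<close> and \<open>q\<close>.
\<close>

definition hat ::
  "('v::real_vector \<Rightarrow> 'v \<Rightarrow> real) \<Rightarrow> nat \<Rightarrow> 'v tensor \<Rightarrow> 'v tensor \<Rightarrow> 'v tensor" where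
  "hat h k X \<alpha> = (\<lambda>vs. if length vs = k then
     (1 / real k) * (\<Sum>(r, s) \<in> {(r, s). r < k \<and> s < k \<and> r \<noteq> s}.
        contract h (\<lambda>p p'. contract h (\<lambda>q q'.
          X [p', vs!r, vs!s, q'] * \<alpha> (vs[r := p, s := q]))))
     else 0)"

definition mc_mult :: "('v::real_vector \<Rightarrow> 'v \<Rightarrow> real) \<Rightarrow> 'v tensor \<Rightarrow> 'v tensor \<Rightarrow> 'v tensor" where
  "mc_mult h X Y = hat h 4 X Y"

definition MC_W :: "('v::real_vector \<Rightarrow> 'v \<Rightarrow> real) \<Rightarrow> 'v tensor set" where
  "MC_W h = {Y \<in> MC. ric h Y = 0}"

definition is_subalgebra ::
  "'v tensor set \<Rightarrow> ('v tensor \<Rightarrow> 'v tensor \<Rightarrow> 'v tensor) \<Rightarrow> 'v tensor set \<Rightarrow> bool" where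
  "is_subalgebra A m S \<longleftrightarrow> S \<subseteq> A \<and> tensor.subspace S \<and> (\<forall>X\<in>S. \<forall>Y\<in>S. m X Y \<in> S)"

end

theory Submission
  imports Defs
begin

text \<open>
  The sum defining \<open>hat h k X\<close> runs over all ordered pairs of positions, so \<open>hat h k X\<close> commutes
  with permutations of the indices; hence \<open>hat h 4 X Y\<close> inherits the symmetries of \<open>Y\<close>, pair by
  pair and before contracting. The pair symmetry of \<open>X\<close> identifies the terms of \<open>(r, s)\<close> and
  \<open>(s, r)\<close>, leaving six terms. Under the Ricci contraction of positions \<open>0\<close> and \<open>3\<close>, the pairs
  \<open>(0, 3)\<close> and \<open>(1, 2)\<close> yield the two terms of the formula, while \<open>(0, 1)\<close> cancels \<open>(1, 3)\<close> and
  \<open>(0, 2)\<close> cancels \<open>(2, 3)\<close>, by the symmetries of \<open>X\<close>.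
\<close>

section \<open>Formal rules for contractions\<close>

lemma contract_add:
  "contract h (\<lambda>p p'. S p p' + T p p') = contract h S + contract h T"
  by (simp add: contract_def Let_def sum.distrib)

lemma contract_cmult: "contract h (\<lambda>p p'. c * T p p') = c * contract h T"
  by (simp add: contract_def Let_def sum_distrib_left)

lemma contract_multc: "contract h (\<lambda>p p'. T p p' * c) = contract h T * c"
  by (simp add: contract_def Let_def sum_distrib_right)

lemma contract_minus: "contract h (\<lambda>p p'. - T p p') = - contract h T"
  by (simp add: contract_def Let_def sum_negf)

lemma contract_commute:
  "contract h (\<lambda>p p'. contract h (\<lambda>q q'. T p p' q q')) =
   contract h (\<lambda>q q'. contract h (\<lambda>p p'. T p p' q q'))"
  unfolding contract_def Let_def by (rule sum.swap)

lemma contract_cong: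
  "(\<And>p p'. S p p' = T p p') \<Longrightarrow> contract h S = contract h T"
  by presburger

text \<open>Carries the Ricci contraction, outermost on the left, inside those of
  \<open>hat\<close>, where factors free of \<open>a\<close> and \<open>a'\<close> can be pulled out
  of it.\<close>

lemma contract_rotate:
  "contract h (\<lambda>a a'. contract h (\<lambda>p p'. contract h (\<lambda>q q'. T a a' p p' q q'))) =
   contract h (\<lambda>p p'. contract h (\<lambda>q q'. contract h (\<lambda>a a'. T a a' p p' q q')))"
  by (subst contract_commute) (rule contract_cong, rule contract_commute)

lemma linear_contract:
  assumes "\<And>p p'. linear (\<lambda>x. T x p p')"
  shows "linear (\<lambda>x. contract h (T x))"
  unfolding contract_def Let_def using assms by (intro linear_compose_sum) blast

lemma linear_mult_const:
  fixes f :: "'v::real_vector \<Rightarrow> real"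
  assumes "linear f"
  shows "linear (\<lambda>x. c * f x)" "linear (\<lambda>x. f x * c)"
  using linear_compose_scale_right[OF assms, of c] by (simp_all add: mult.commute)

text \<open>\<open>contract\<close> fills one slot with basis vectors and the other with dual
  vectors. Expanding the basis vectors in the dual basis, with coefficients \<open>h b c\<close>,
  turns both sides into the same double sum, because \<open>h\<close> is symmetric.\<close>

lemma contract_flip:
  assumes h: "metric_vector_space h" and T: "bilinear T"
  shows "contract h (\<lambda>p p'. T p' p) = contract h T"
proof -
  define B :: "'a set" where "B = (SOME C. is_basis C)"
  have B: "is_basis B"
    using is_basis_exists[OF h] unfolding B_def by (rule someI_ex)
  let ?d = "hdual h B"
  have lin: "linear (T x)" "linear (\<lambda>x. T x y)" for x y
    using T unfolding bilinear_def by blast+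
  have sym: "h x y = h y x" for x y
    using h unfolding metric_vector_space_def by blast
  have 1: "T b x = (\<Sum>c\<in>B. h b c * T (?d c) x)" for b x
  proof -
    have "T b x = T (\<Sum>c\<in>B. h b c *\<^sub>R ?d c) x"
      using basis_expand(2)[OF h B, of b] by simp
    then show ?thesis by (simp add: linear_sum[OF lin(2)] linear_scale[OF lin(2)])
  qed
  have 2: "T x b = (\<Sum>c\<in>B. h b c * T x (?d c))" for b x
  proof -
    have "T x b = T x (\<Sum>c\<in>B. h b c *\<^sub>R ?d c)"
      using basis_expand(2)[OF h B, of b] by simp
    then show ?thesis by (simp add: linear_sum[OF lin(1)] linear_scale[OF lin(1)])
  qed
  have "(\<Sum>b\<in>B. T (?d b) b) = (\<Sum>b\<in>B. \<Sum>c\<in>B. h b c * T (?d b) (?d c))"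
    using 2 by (intro sum.cong refl)
  also have "\<dots> = (\<Sum>b\<in>B. \<Sum>c\<in>B. h b c * T (?d c) (?d b))"
    by (subst sum.swap) (simp add: sym)
  also have "\<dots> = (\<Sum>b\<in>B. T b (?d b))"
    by (intro sum.cong refl 1[symmetric])
  finally show ?thesis unfolding contract_def Let_def B_def .
qed

section \<open>Multilinearity and symmetries of curvature tensors\<close>

lemma tensors_4_linear:
  assumes "Y \<in> tensors 4"
  shows "linear (\<lambda>x. Y [x,j,k,l])" "linear (\<lambda>x. Y [i,x,k,l])"
    "linear (\<lambda>x. Y [i,j,x,l])" "linear (\<lambda>x. Y [i,j,k,x])"
proof -
  have lin: "linear (\<lambda>v. Y (vs[r := v]))" if "length vs = 4" "r < 4" for vs r
    using assms that unfolding tensors_def by blast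
  \<comment> \<open>The \<open>0\<close> in each list is a placeholder, overwritten by the update at
    its position.\<close>
  show "linear (\<lambda>x. Y [x,j,k,l])" using lin[of "[0,j,k,l]" 0] by simp
  show "linear (\<lambda>x. Y [i,x,k,l])" using lin[of "[i,0,k,l]" 1] by simp
  show "linear (\<lambda>x. Y [i,j,x,l])" using lin[of "[i,j,0,l]" 2] by simp
  show "linear (\<lambda>x. Y [i,j,k,x])" using lin[of "[i,j,k,0]" 3] by simp
qed

lemma length_4_cases:
  assumes "length vs = 4"
  obtains i j k l where "vs = [i,j,k,l]"
  using assms by (auto simp: numeral_eq_Suc length_Suc_conv)

lemma tensors_4I:
  assumes "\<And>j k l. linear (\<lambda>x. Y [x,j,k,l])" "\<And>i k l. linear (\<lambda>x. Y [i,x,k,l])"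
    "\<And>i j l. linear (\<lambda>x. Y [i,j,x,l])" "\<And>i j k. linear (\<lambda>x. Y [i,j,k,x])"
    and "\<And>vs. length vs \<noteq> 4 \<Longrightarrow> Y vs = 0"
  shows "Y \<in> tensors 4"
proof -
  have "linear (\<lambda>v. Y (vs[r := v]))" if vs: "length vs = 4" and r: "r < 4" for vs r
  proof -
    obtain i j k l where "vs = [i,j,k,l]" using length_4_cases[OF vs] .
    moreover have "r = 0 \<or> r = 1 \<or> r = 2 \<or> r = 3" using r by linarith
    ultimately show ?thesis using assms(1-4) by auto
  qed
  then show ?thesis using assms(5) unfolding tensors_def by blast
qed

lemma MC_tensors: "Y \<in> MC \<Longrightarrow> Y \<in> tensors 4"
  unfolding MC_def by simp

lemma MC_antisym12:
  assumes "Y \<in> MC" shows "Y [i,j,k,l] = - Y [j,i,k,l]"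
proof -
  have "(1/2) * (Y [i,j,k,l] - Y [j,i,k,l]) = Y [i,j,k,l]"
    using assms unfolding MC_def by blast
  then show ?thesis by simp
qed

lemma MC_antisym34:
  assumes "Y \<in> MC" shows "Y [i,j,k,l] = - Y [i,j,l,k]"
proof -
  have "Y [i,j,k,l] = (1/2) * (Y [i,j,k,l] - Y [i,j,l,k])"
    using assms unfolding MC_def by blast
  then show ?thesis by simp
qed

text \<open>By antisymmetry in the first two slots the odd permutations repeat the even ones, so the
  antisymmetrization collapses to a multiple of the cyclic sum.\<close>

lemma MC_bianchi:
  assumes "Y \<in> MC" shows "Y [i,j,k,l] + Y [j,k,i,l] + Y [k,i,j,l] = 0"
proof -
  have "(1/6) * (Y [i,j,k,l] + Y [j,k,i,l] + Y [k,i,j,l]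
               - Y [j,i,k,l] - Y [i,k,j,l] - Y [k,j,i,l]) = 0"
    using assms unfolding MC_def by blast
  then show ?thesis
    using MC_antisym12[OF assms, of i j k l] MC_antisym12[OF assms, of j k i l]
      MC_antisym12[OF assms, of k i j l] by simp
qed

lemma MCI:
  assumes "Y \<in> tensors 4" and a: "\<And>i j k l. Y [i,j,k,l] = - Y [j,i,k,l]"
    and "\<And>i j k l. Y [i,j,k,l] = - Y [i,j,l,k]"
    and b: "\<And>i j k l. Y [i,j,k,l] + Y [j,k,i,l] + Y [k,i,j,l] = 0"
  shows "Y \<in> MC"
proof -
  have "Y [i,j,k,l] + Y [j,k,i,l] + Y [k,i,j,l]
      - Y [j,i,k,l] - Y [i,k,j,l] - Y [k,j,i,l] = 0" for i j k l
    using b[of i j k l] a[of i j k l] a[of j k i l] a[of k i j l] by linarith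
  moreover have "Y [i,j,k,l] - Y [j,i,k,l] = 2 * Y [i,j,k,l]" for i j k l
    using a[of i j k l] by linarith
  moreover have "Y [i,j,k,l] - Y [i,j,l,k] = 2 * Y [i,j,k,l]" for i j k l
    using assms(3)[of i j k l] by linarith
  ultimately show ?thesis using assms(1) unfolding MC_def by auto
qed

text \<open>Modulo the antisymmetries, the Bianchi identity with last index \<open>l\<close> minus
  that with last index \<open>k\<close> reads \<open>2 * Y [i,j,k,l]\<close> plus four terms; the
  one for \<open>j\<close> minus the one for \<open>i\<close> reads \<open>2 * Y [k,l,i,j]\<close>
  plus the same four terms.\<close>

lemma MC_pair_sym:
  assumes "Y \<in> MC" shows "Y [i,j,k,l] = Y [k,l,i,j]"
proof -
  note a = MC_antisym12[OF assms] and b = MC_antisym34[OF assms] and c = MC_bianchi[OF assms]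
  show ?thesis
    using c[of i j k l] c[of j k l i] c[of k l i j] c[of l i j k]
      a[of k i j l] a[of l j k i] a[of l i j k] a[of i k l j] a[of i j l k] a[of j l k i] a[of i l k j]
      a[of k l i j] a[of j k l i]
      b[of i j k l] b[of j k i l] b[of k i j l] b[of k l i j] b[of l i j k] b[of l j k i]
      b[of j l k i] b[of i k l j] b[of i l j k] b[of i l k j]
    by linarith
qed

lemma MC_double_swap:
  assumes "Y \<in> MC" shows "Y [i,j,k,l] = Y [j,i,l,k]"
  by (simp add: MC_antisym12[OF assms, of i j] MC_antisym34[OF assms, of j i k l])

text \<open>Exchanging the pairs and then swapping inside each reverses the indices. This is what
  undoes an exchange of the two positions in \<open>hat\<close>.\<close>

lemma MC_reverse:
  assumes "Y \<in> MC" shows "Y [i,j,k,l] = Y [l,k,j,i]"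
  by (metis MC_pair_sym[OF assms] MC_double_swap[OF assms])

section \<open>Explicit forms of the operators\<close>

lemma hat_2:
  "hat h 2 X \<alpha> [j,k] = (1/2) * contract h (\<lambda>p p'. contract h (\<lambda>q q'.
     X [p',j,k,q'] * \<alpha> [p,q] + X [p',k,j,q'] * \<alpha> [q,p]))"
proof -
  have "{(r, s). r < (2::nat) \<and> s < 2 \<and> r \<noteq> s} = {(0,1), (1,0)}"
    by auto
  then show ?thesis by (simp add: hat_def contract_add)
qed

text \<open>The two ordered pairs contribute equally, which absorbs the factor 1/2. By
  \<open>MC_double_swap\<close> the result is \<open>\<alpha>\<close> contracted with the two middle
  slots of \<open>X\<close>, the usual formula on symmetric forms.\<close>

lemma hat_2_MC:
  assumes "X \<in> MC"
  shows "hat h 2 X \<alpha> [j,k] =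
    contract h (\<lambda>p p'. contract h (\<lambda>q q'. X [p',j,k,q'] * \<alpha> [p,q]))"
proof -
  have "contract h (\<lambda>p p'. contract h (\<lambda>q q'. X [p',k,j,q'] * \<alpha> [q,p])) =
        contract h (\<lambda>p p'. contract h (\<lambda>q q'. X [p',j,k,q'] * \<alpha> [p,q]))"
    by (subst contract_commute) (simp add: MC_reverse[OF assms, of _ k j])
  then show ?thesis by (simp add: hat_2 contract_add)
qed

lemma hat_4:
  "hat h 4 X Y [i,j,k,l] = (1/4) * contract h (\<lambda>p p'. contract h (\<lambda>q q'.
     X [p',i,j,q'] * Y [p,q,k,l] + X [p',j,i,q'] * Y [q,p,k,l] +
     X [p',i,k,q'] * Y [p,j,q,l] + X [p',k,i,q'] * Y [q,j,p,l] +
     X [p',i,l,q'] * Y [p,j,k,q] + X [p',l,i,q'] * Y [q,j,k,p] +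
     X [p',j,k,q'] * Y [i,p,q,l] + X [p',k,j,q'] * Y [i,q,p,l] +
     X [p',j,l,q'] * Y [i,p,k,q] + X [p',l,j,q'] * Y [i,q,k,p] +
     X [p',k,l,q'] * Y [i,j,p,q] + X [p',l,k,q'] * Y [i,j,q,p]))"
proof -
  have "{(r, s). r < (4::nat) \<and> s < 4 \<and> r \<noteq> s} =
    {(0,1), (1,0), (0,2), (2,0), (0,3), (3,0), (1,2), (2,1), (1,3), (3,1), (2,3), (3,2)}"
    by (auto simp: less_Suc_eq numeral_eq_Suc)
  then show ?thesis by (simp add: hat_def contract_add numeral_eq_Suc)
qed

lemma hat_4_MC:
  assumes "X \<in> MC"
  shows "hat h 4 X Y [i,j,k,l] = (1/2) * contract h (\<lambda>p p'. contract h (\<lambda>q q'.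
     X [p',i,j,q'] * Y [p,q,k,l] + X [p',i,k,q'] * Y [p,j,q,l] +
     X [p',i,l,q'] * Y [p,j,k,q] + X [p',j,k,q'] * Y [i,p,q,l] +
     X [p',j,l,q'] * Y [i,p,k,q] + X [p',k,l,q'] * Y [i,j,p,q]))"
proof -
  \<comment> \<open>Here \<open>\<alpha>\<close> stands for \<open>Y\<close> as a function of its
    two replaced slots, so that one exchange serves all six pairs of positions.\<close>
  have swap: "contract h (\<lambda>p p'. contract h (\<lambda>q q'. X [p',v,u,q'] * \<alpha> q p)) =
        contract h (\<lambda>p p'. contract h (\<lambda>q q'. X [p',u,v,q'] * \<alpha> p q))" for u v \<alpha>
    by (subst contract_commute) (simp add: MC_reverse[OF assms, of _ v u])
  show ?thesis
    by (simp add: hat_4 contract_add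
        swap[of j i "\<lambda>p q. Y [p,q,k,l]"] swap[of k i "\<lambda>p q. Y [p,j,q,l]"]
        swap[of l i "\<lambda>p q. Y [p,j,k,q]"] swap[of k j "\<lambda>p q. Y [i,p,q,l]"]
        swap[of l j "\<lambda>p q. Y [i,p,k,q]"] swap[of l k "\<lambda>p q. Y [i,j,p,q]"])
qed

lemma hat_4_in_MC:
  assumes X: "X \<in> tensors 4" and Y: "Y \<in> MC"
  shows "hat h 4 X Y \<in> MC"
proof (rule MCI)
  note a = MC_antisym12[OF Y] and b = MC_antisym34[OF Y] and c = MC_bianchi[OF Y]
  note lin = tensors_4_linear[OF X] tensors_4_linear[OF MC_tensors[OF Y]]
  show "hat h 4 X Y \<in> tensors 4"
  proof (rule tensors_4I)
    show "linear (\<lambda>x. hat h 4 X Y [x,j,k,l])" for j k l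
      unfolding hat_4 by (intro linear_mult_const linear_contract linear_compose_add lin)
    show "linear (\<lambda>x. hat h 4 X Y [i,x,k,l])" for i k l
      unfolding hat_4 by (intro linear_mult_const linear_contract linear_compose_add lin)
    show "linear (\<lambda>x. hat h 4 X Y [i,j,x,l])" for i j l
      unfolding hat_4 by (intro linear_mult_const linear_contract linear_compose_add lin)
    show "linear (\<lambda>x. hat h 4 X Y [i,j,k,x])" for i j k
      unfolding hat_4 by (intro linear_mult_const linear_contract linear_compose_add lin)
  qed (simp add: hat_def)
  fix i j k l
  let ?F = "\<lambda>i j k l p p' q q'.
     X [p',i,j,q'] * Y [p,q,k,l] + X [p',j,i,q'] * Y [q,p,k,l] +
     X [p',i,k,q'] * Y [p,j,q,l] + X [p',k,i,q'] * Y [q,j,p,l] +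
     X [p',i,l,q'] * Y [p,j,k,q] + X [p',l,i,q'] * Y [q,j,k,p] +
     X [p',j,k,q'] * Y [i,p,q,l] + X [p',k,j,q'] * Y [i,q,p,l] +
     X [p',j,l,q'] * Y [i,p,k,q] + X [p',l,j,q'] * Y [i,q,k,p] +
     X [p',k,l,q'] * Y [i,j,p,q] + X [p',l,k,q'] * Y [i,j,q,p]"
  have F: "hat h 4 X Y [i,j,k,l] =
      (1/4) * contract h (\<lambda>p p'. contract h (\<lambda>q q'. ?F i j k l p p' q q'))" for i j k l
    by (rule hat_4)
  \<comment> \<open>Exchanging \<open>i\<close> and \<open>j\<close> permutes the twelve summands up
    to the order of the first two slots of \<open>Y\<close>; the instances of antisymmetry bring
    these slots into a fixed order.\<close>
  have "?F i j k l p p' q q' = - ?F j i k l p p' q q'" for p p' q q'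
    by (simp add: a[of p q] a[of p j] a[of p i] a[of q j] a[of q i] a[of j i] algebra_simps)
  then show "hat h 4 X Y [i,j,k,l] = - hat h 4 X Y [j,i,k,l]"
    unfolding F by (simp only: contract_minus mult_minus_right)
  have "?F i j k l p p' q q' = - ?F i j l k p p' q q'" for p p' q q'
    by (simp add: b[of _ _ p q] b[of _ _ p k] b[of _ _ p l] b[of _ _ q k] b[of _ _ q l]
        b[of _ _ l k] algebra_simps)
  then show "hat h 4 X Y [i,j,k,l] = - hat h 4 X Y [i,j,l,k]"
    unfolding F by (simp only: contract_minus mult_minus_right)
  \<comment> \<open>The Bianchi identity solved for one of its terms. Only instances at fixed
    indices serve as rewrite rules: the general equation applies to its own right-hand side.\<close>
  have c': "Y [w,u,v,z] = - Y [u,v,w,z] - Y [v,w,u,z]" for u v w z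
    using c[of u v w z] by simp
  have "?F i j k l p p' q q' + ?F j k i l p p' q q' + ?F k i j l p p' q q' = 0" for p p' q q'
    by (simp add: c'[of p q i] c'[of p q j] c'[of p q k] c'[of q p i] c'[of q p j] c'[of q p k]
        c'[of p i j] c'[of p j k] c'[of p k i] c'[of q i j] c'[of q j k] c'[of q k i]
        c'[of i j k] algebra_simps)
  moreover have "hat h 4 X Y [i,j,k,l] + hat h 4 X Y [j,k,i,l] + hat h 4 X Y [k,i,j,l] =
     (1/4) * contract h (\<lambda>p p'. contract h (\<lambda>q q'.
       ?F i j k l p p' q q' + ?F j k i l p p' q q' + ?F k i j l p p' q q'))"
    unfolding F by (simp only: contract_add distrib_left)
  ultimately show "hat h 4 X Y [i,j,k,l] + hat h 4 X Y [j,k,i,l] + hat h 4 X Y [k,i,j,l] = 0"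
    by (simp only: contract_def Let_def sum.neutral_const mult_zero_right)
qed

section \<open>The Ricci contraction of a product\<close>

lemma ric_pair: "ric h Y [j,k] = contract h (\<lambda>p p'. Y [p,j,k,p'])"
  by (simp add: ric_def)

lemma ric_bilinear:
  assumes "Y \<in> tensors 4" shows "bilinear (\<lambda>j k. ric h Y [j,k])"
  unfolding ric_pair bilinear_def
  by (intro conjI allI linear_contract tensors_4_linear[OF assms])

text \<open>Swapping inside both pairs carries the middle slots to the outer ones, which
  \<open>ric\<close> contracts.\<close>

lemma contract_middle:
  assumes "X \<in> MC"
  shows "contract h (\<lambda>p p'. X [u,p,p',v]) = ric h X [u,v]"
  by (simp add: ric_pair MC_double_swap[OF assms, of u _ _ v])

text \<open>Flips the outer contraction, then the inner one. It moves the dual vectors from one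
  factor to the other: \<open>hat\<close> puts them into the operator, \<open>inner2\<close> into
  its second argument.\<close>

lemma contract_flip2:
  assumes h: "metric_vector_space h" and "bilinear \<alpha>" "bilinear \<beta>"
  shows "contract h (\<lambda>p p'. contract h (\<lambda>q q'. \<alpha> p' q' * \<beta> p q)) =
         contract h (\<lambda>p p'. contract h (\<lambda>q q'. \<alpha> p q * \<beta> p' q'))"
proof -
  have lin: "linear (\<alpha> x)" "linear (\<lambda>x. \<alpha> x y)" "linear (\<beta> x)" "linear (\<lambda>x. \<beta> x y)" for x y
    using assms unfolding bilinear_def by blast+
  have "contract h (\<lambda>p p'. contract h (\<lambda>q q'. \<alpha> p' q' * \<beta> p q)) =
      contract h (\<lambda>p p'. contract h (\<lambda>q q'. \<alpha> p q' * \<beta> p' q))"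
    by (rule contract_flip[OF h])
      (auto simp: bilinear_def intro!: linear_contract linear_mult_const lin)
  also have "\<dots> = contract h (\<lambda>p p'. contract h (\<lambda>q q'. \<alpha> p q * \<beta> p' q'))"
    by (rule contract_cong, rule contract_flip[OF h])
      (auto simp: bilinear_def intro!: linear_mult_const lin)
  finally show ?thesis .
qed

lemma ric_hat_4:
  assumes h: "metric_vector_space h" and X: "X \<in> MC" and Y: "Y \<in> MC"
  shows "ric h (hat h 4 X Y) [j,k] =
    (1/2) * (hat h 2 X (ric h Y) [j,k] + hat h 2 Y (ric h X) [j,k])"
proof -
  note linX = tensors_4_linear[OF MC_tensors[OF X]] and linY = tensors_4_linear[OF MC_tensors[OF Y]]
  let ?C = "\<lambda>T. contract h (\<lambda>a a'. contract h (\<lambda>p p'. contract h (\<lambda>q q'. T a a' p p' q q')))"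
  \<comment> \<open>This treats pairs containing exactly one of the contracted positions:
    \<open>u\<close> is the free index that enters \<open>X\<close>, and \<open>\<alpha>\<close> is
    \<open>Y\<close> with the other free index held fixed. Linearity of \<open>\<alpha> p q\<close>
    is needed to flip \<open>a\<close> and \<open>a'\<close>.\<close>
  have cancel: "?C (\<lambda>a a' p p' q q'. X [p',a,u,q'] * \<alpha> p q a') +
      ?C (\<lambda>a a' p p' q q'. X [p',u,a',q'] * \<alpha> a p q) = 0"
    if \<alpha>: "\<And>p q. linear (\<alpha> p q)" for u \<alpha>
  proof -
    have "?C (\<lambda>a a' p p' q q'. X [p',a,u,q'] * \<alpha> p q a') =
        ?C (\<lambda>p p' q q' a a'. X [p',a,u,q'] * \<alpha> p q a')"
      by (rule contract_rotate)
    also have "\<dots> = ?C (\<lambda>p p' q q' a a'. X [p',a',u,q'] * \<alpha> p q a)"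
    proof -
      have "contract h (\<lambda>a a'. X [p',a,u,q'] * \<alpha> p q a') =
          contract h (\<lambda>a a'. X [p',a',u,q'] * \<alpha> p q a)" for p p' q q'
        by (rule contract_flip[OF h, symmetric])
          (auto simp: bilinear_def intro!: linear_mult_const linX \<alpha>)
      then show ?thesis by simp
    qed
    \<comment> \<open>Renaming the bound triple \<open>p, q, a\<close> as \<open>a, p, q\<close>
      turns \<open>X [p',a',u,q']\<close> into \<open>X [a',q',u,p']\<close>; only the symmetries of
      \<open>X\<close> remain to be used.\<close>
    also have "\<dots> = ?C (\<lambda>a a' p p' q q'. - (X [p',u,a',q'] * \<alpha> a p q))"
    proof -
      have "X [a',q',u,p'] = - X [p',u,a',q']" for a' p' q'
        by (metis MC_pair_sym[OF X] MC_antisym12[OF X])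
      then show ?thesis by simp
    qed
    finally show ?thesis by (simp add: contract_minus)
  qed
  \<comment> \<open>Pair \<open>(1, 2)\<close>: \<open>a\<close> and \<open>a'\<close> stay in the
    outer slots of \<open>Y\<close>, and contracting them first gives
    \<open>ric h Y\<close>.\<close>
  have XY: "?C (\<lambda>a a' p p' q q'. X [p',j,k,q'] * Y [a,p,q,a']) = hat h 2 X (ric h Y) [j,k]"
    unfolding contract_rotate[of h] hat_2_MC[OF X] ric_pair contract_cmult ..
  \<comment> \<open>Pair \<open>(0, 3)\<close>: \<open>a\<close> and \<open>a'\<close> enter the
    middle slots of \<open>X\<close>, giving \<open>ric h X\<close>; the double flip then moves the
    dual vectors back to \<open>Y\<close>.\<close>
  have "?C (\<lambda>a a' p p' q q'. X [p',a,a',q'] * Y [p,j,k,q]) =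
      contract h (\<lambda>p p'. contract h (\<lambda>q q'. ric h X [p',q'] * Y [p,j,k,q]))"
    unfolding contract_rotate[of h] contract_multc contract_middle[OF X] ..
  also have "\<dots> = contract h (\<lambda>p p'. contract h (\<lambda>q q'. ric h X [p,q] * Y [p',j,k,q']))"
    by (rule contract_flip2[OF h ric_bilinear[OF MC_tensors[OF X]]])
      (auto simp: bilinear_def intro!: linY)
  also have "\<dots> = hat h 2 Y (ric h X) [j,k]"
    unfolding hat_2_MC[OF Y] by (simp only: mult.commute)
  finally have YX: "?C (\<lambda>a a' p p' q q'. X [p',a,a',q'] * Y [p,j,k,q]) = hat h 2 Y (ric h X) [j,k]" .
  have kl: "?C (\<lambda>a a' p p' q q'. X [p',a,k,q'] * Y [p,j,q,a']) +
      ?C (\<lambda>a a' p p' q q'. X [p',k,a',q'] * Y [a,j,p,q]) = 0"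
    by (rule cancel) (rule linY)
  have ij: "?C (\<lambda>a a' p p' q q'. X [p',a,j,q'] * Y [p,q,k,a']) +
      ?C (\<lambda>a a' p p' q q'. X [p',j,a',q'] * Y [a,p,k,q]) = 0"
    by (rule cancel) (rule linY)
  show ?thesis
    unfolding ric_pair[of h "hat h 4 X Y"] hat_4_MC[OF X] contract_cmult contract_add
    using XY YX ij kl by simp
qed

lemma ric_mc_mult:
  assumes "metric_vector_space h" "X \<in> MC" "Y \<in> MC"
  shows "ric h (mc_mult h X Y) = tscale (1/2) (hat h 2 X (ric h Y) + hat h 2 Y (ric h X))"
proof
  fix vs
  show "ric h (mc_mult h X Y) vs =
      tscale (1/2) (hat h 2 X (ric h Y) + hat h 2 Y (ric h X)) vs"
  \<comment> \<open>On lists of any other length both sides take the default value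
    \<open>0\<close>.\<close>
  proof (cases "length vs = 2")
    case True
    then obtain j k where "vs = [j,k]"
      by (auto simp: numeral_eq_Suc length_Suc_conv)
    then show ?thesis using ric_hat_4[OF assms] by (simp add: mc_mult_def tscale_def)
  qed (simp add: ric_def tscale_def hat_def)
qed

section \<open>The scalar trace\<close>

lemma contract_hat_2:
  assumes h: "metric_vector_space h" and X: "X \<in> MC" and Y: "Y \<in> MC"
  shows "contract h (\<lambda>i i'. hat h 2 X (ric h Y) [i,i']) = inner2 h (ric h X) (ric h Y)"
proof -
  have "contract h (\<lambda>i i'. hat h 2 X (ric h Y) [i,i']) =
      contract h (\<lambda>p p'. contract h (\<lambda>q q'. contract h (\<lambda>i i'. X [p',i,i',q'] * ric h Y [p,q])))"
    unfolding hat_2_MC[OF X] by (rule contract_rotate)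
  \<comment> \<open>The trace over the free indices falls on the middle slots of
    \<open>X\<close>.\<close>
  also have "\<dots> = contract h (\<lambda>p p'. contract h (\<lambda>q q'. ric h X [p',q'] * ric h Y [p,q]))"
    unfolding contract_multc contract_middle[OF X] ..
  also have "\<dots> = inner2 h (ric h X) (ric h Y)"
    unfolding inner2_def
    by (rule contract_flip2[OF h ric_bilinear ric_bilinear]) (use X Y MC_tensors in blast)+
  finally show ?thesis .
qed

text \<open>The arguments play different roles, since only the second receives dual vectors; the
  double flip exchanges these roles.\<close>

lemma inner2_commute:
  assumes h: "metric_vector_space h" and "X \<in> tensors 4" "Y \<in> tensors 4"
  shows "inner2 h (ric h Y) (ric h X) = inner2 h (ric h X) (ric h Y)"
  unfolding inner2_def
  \<comment> \<open>\<open>ric_bilinear\<close> leaves the form inside each \<open>ric\<close>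
    schematic, hence the two instantiations by \<open>h\<close>.\<close>
  using contract_flip2[OF h ric_bilinear[OF assms(2)] ric_bilinear[OF assms(3)], of h h]
  by (simp add: mult.commute)

text \<open>Both terms of the Ricci formula have the same trace, so the factor 1/2 cancels.\<close>

lemma scal_mc_mult:
  assumes "metric_vector_space h" "X \<in> MC" "Y \<in> MC"
  shows "scal h (mc_mult h X Y) = inner2 h (ric h X) (ric h Y)"
  unfolding scal_def mc_mult_def ric_hat_4[OF assms] contract_cmult contract_add
    contract_hat_2[OF assms] contract_hat_2[OF assms(1,3,2)]
  using inner2_commute[OF assms(1)] assms MC_tensors by auto

section \<open>The Weyl subalgebra\<close>

lemma MC_subspace: "tensor.subspace MC"
proof (rule tensor.subspaceI)
  show "0 \<in> MC"
    by (intro MCI tensors_4I) (simp_all add: linear_zero)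
next
  fix X Y :: "'a tensor" assume X: "X \<in> MC" and Y: "Y \<in> MC"
  note lin = tensors_4_linear[OF MC_tensors[OF X]] tensors_4_linear[OF MC_tensors[OF Y]]
  have "X + Y \<in> tensors 4"
    using MC_tensors[OF X] MC_tensors[OF Y]
    by (intro tensors_4I) (auto intro!: linear_compose_add lin simp: tensors_def)
  then show "X + Y \<in> MC"
  proof (rule MCI)
    fix i j k l
    show "(X + Y) [i,j,k,l] + (X + Y) [j,k,i,l] + (X + Y) [k,i,j,l] = 0"
      using MC_bianchi[OF X, of i j k l] MC_bianchi[OF Y, of i j k l] by simp
    show "(X + Y) [i,j,k,l] = - (X + Y) [j,i,k,l]"
      using MC_antisym12[OF X, of i j k l] MC_antisym12[OF Y, of i j k l] by simp
    show "(X + Y) [i,j,k,l] = - (X + Y) [i,j,l,k]"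
      using MC_antisym34[OF X, of i j k l] MC_antisym34[OF Y, of i j k l] by simp
  qed
next
  fix c and X :: "'a tensor" assume X: "X \<in> MC"
  have "tscale c X \<in> tensors 4"
    using MC_tensors[OF X] unfolding tscale_def
    by (intro tensors_4I)
      (auto intro!: linear_mult_const tensors_4_linear simp: tensors_def)
  then show "tscale c X \<in> MC"
  proof (rule MCI)
    fix i j k l
    show "tscale c X [i,j,k,l] + tscale c X [j,k,i,l] + tscale c X [k,i,j,l] = 0"
      using MC_bianchi[OF X, of i j k l] by (simp add: tscale_def flip: distrib_left)
    show "tscale c X [i,j,k,l] = - tscale c X [j,i,k,l]"
      by (simp add: tscale_def MC_antisym12[OF X, of i j])
    show "tscale c X [i,j,k,l] = - tscale c X [i,j,l,k]"
      by (simp add: tscale_def MC_antisym34[OF X, of i j k l])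
  qed
qed

lemma ric_add: "ric h (X + Y) = ric h X + ric h Y"
  by (auto simp: ric_def fun_eq_iff contract_add)

lemma ric_tscale: "ric h (tscale c X) = tscale c (ric h X)"
  by (auto simp: ric_def tscale_def fun_eq_iff contract_cmult)

lemma MC_W_subspace: "tensor.subspace (MC_W h)"
proof (rule tensor.subspaceI)
  show "0 \<in> MC_W h"
    by (simp add: MC_W_def ric_def contract_def fun_eq_iff tensor.subspace_0[OF MC_subspace])
next
  fix X Y assume "X \<in> MC_W h" "Y \<in> MC_W h"
  then show "X + Y \<in> MC_W h"
    by (simp add: MC_W_def ric_add tensor.subspace_add[OF MC_subspace])
next
  fix c X assume "X \<in> MC_W h"
  then show "tscale c X \<in> MC_W h"
    by (simp add: MC_W_def ric_tscale tensor.subspace_scale[OF MC_subspace])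
qed

lemma hat_zero_right: "hat h k X 0 = 0"
  by (simp add: hat_def contract_def fun_eq_iff)

text \<open>Each term of the Ricci formula applies an operator to a vanishing Ricci tensor;
  \<open>hat_4_in_MC\<close> keeps the product inside \<open>MC\<close>.\<close>

lemma MC_W_mult_closed:
  assumes "metric_vector_space h" "X \<in> MC_W h" "Y \<in> MC_W h"
  shows "mc_mult h X Y \<in> MC_W h"
proof -
  have XY: "X \<in> MC" "Y \<in> MC" "ric h X = 0" "ric h Y = 0"
    using assms unfolding MC_W_def by blast+
  then have "ric h (mc_mult h X Y) = 0"
    using ric_mc_mult[OF assms(1), of X Y] by (simp add: hat_zero_right)
  then show ?thesis
    using hat_4_in_MC[OF MC_tensors] XY unfolding MC_W_def mc_mult_def by blast
qed

theorem lemma5p7: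
  fixes h :: "'v::real_vector \<Rightarrow> 'v \<Rightarrow> real"
  assumes "metric_vector_space h"
  shows "(\<forall>X\<in>MC. \<forall>Y\<in>MC.
            ric h (mc_mult h X Y) = tscale (1/2) (hat h 2 X (ric h Y) + hat h 2 Y (ric h X)) \<and>
            scal h (mc_mult h X Y) = inner2 h (ric h X) (ric h Y))
         \<and> is_subalgebra MC (mc_mult h) (MC_W h)"
  using ric_mc_mult[OF assms] scal_mc_mult[OF assms] MC_W_mult_closed[OF assms] MC_W_subspace
  unfolding is_subalgebra_def by (auto simp: MC_W_def)

end
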